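(* Let $\mathbf{R}(\mathbf{u})=\mathbf{A}\mathbf{u}$ with $\mathbf{A}\in\mathbb{R}^{N\times N}$ a constant matrix (a linear time-invariant operator), let $\mathbf{u}_F:[0,T]\to\mathbb{R}^N$ solve $\frac{d\mathbf{u}_F}{dt}=\mathbf{A}\mathbf{u}_F$, $\mathbf{u}_F(0)=\mathbf{u}_0$, and let $\tilde{\mathbf{u}}_F=\tilde{\Pi}\mathbf{u}_F$. Let $\mathbb{P}_G=\tilde{\Pi}$ and $\mathbb{P}_A=\tilde{\Pi}[\mathbf{I}+\tau\mathbf{A}\Pi']$. Then for all $t\in[0,T]$ and $0\le\tau\le t$, $$\|\tilde{\mathbf{V}}^T\mathbb{P}_G\mathbf{r}_F(\tilde{\mathbf{u}}_F(t))\|_2\le\Big\|\tilde{\mathbf{V}}^T\mathbf{A}\int_0^{\tau}e^{\Pi'\mathbf{A}\zeta}\Pi'\mathbf{A}\tilde{\mathbf{u}}_F(t-\zeta)\,d\zeta\Big\|_2+\Big\|\tilde{\mathbf{V}}^T\mathbf{A}\int_{\tau}^{t}e^{\Pi'\mathbf{A}\zeta}\Pi'\mathbf{A}\tilde{\mathbf{u}}_F(t-\zeta)\,d\zeta\Big\|_2,$$ $$\|\tilde{\mathbf{V}}^T\mathbb{P}_A\mathbf{r}_F(\tilde{\mathbf{u}}_F(t))\|_2\le\Big\|\tilde{\mathbf{V}}^T\mathbf{A}\int_0^{\tau}e^{\Pi'\mathbf{A}\zeta}\Pi'\mathbf{A}\tilde{\mathbf{u}}_F(t-\zeta)\,d\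zeta-\tau\tilde{\mathbf{V}}^T\mathbf{A}\Pi'\mathbf{A}\tilde{\mathbf{u}}_F(t)\Big\|_2+\Big\|\tilde{\mathbf{V}}^T\mathbf{A}\int_{\tau}^{t}e^{\Pi'\mathbf{A}\zeta}\Pi'\mathbf{A}\tilde{\mathbf{u}}_F(t-\zeta)\,d\zeta\Big\|_2.$$
   Context: $N,K$ are positive integers with $K\le N$, and $T>0$. $\tilde{\mathbf{V}}\in\mathbb{R}^{N\times K}$ is a matrix with orthonormal columns (the coarse-scale trial basis). $\tilde{\Pi}=\tilde{\mathbf{V}}\tilde{\mathbf{V}}^T$ and $\Pi'=\mathbf{I}-\tilde{\mathbf{V}}\tilde{\mathbf{V}}^T$. The initial condition satisfies $\mathbf{u}_0\in\mathrm{Range}(\tilde{\mathbf{V}})$. The residual of the full-order model is $\mathbf{r}_F(\mathbf{u})=\frac{d\mathbf{u}}{dt}-\mathbf{A}\mathbf{u}$ for a differentiable trajectory $\mathbf{u}$, so $\mathbf{r}_F(\tilde{\mathbf{u}}_F(t))=\frac{d\tilde{\mathbf{u}}_F}{dt}(t)-\mathbf{A}\tilde{\mathbf{u}}_F(t)$. $e^{\Pi'\mathbf{A}\zeta}$ is the matrix exponential and $\|\cdot\|_2$ is the Euclidean norm. $\mathbb{P}_G$ and $\mathbb{P}_A$ are the projections of the Galerkin and Adjoint Petrov--Galerkin reduced-order models, and $\tau$ is the memory length parameter of the latter. *)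

theory Defs
  imports "HOL-Analysis.Analysis"
begin

definition orthonormal_columns :: "real^'k^'n \<Rightarrow> bool" where
  "orthonormal_columns V \<longleftrightarrow>
     (\<forall>i j. column i V \<bullet> column j V = (if i = j then 1 else 0))"

definition coarse_proj :: "real^'k^'n \<Rightarrow> real^'n^'n" where
  "coarse_proj V = V ** transpose V"

definition fine_proj :: "real^'k^'n \<Rightarrow> real^'n^'n" where
  "fine_proj V = mat 1 - V ** transpose V"

text \<open>The class-based \<open>power\<close> and \<open>exp\<close> are not available for the matrix product:
  multiplication on the vector type is componentwise.\<close>

primrec matrix_power :: "real^'n^'n \<Rightarrow> nat \<Rightarrow> real^'n^'n" where
  "matrix_power M 0 = mat 1"
| "matrix_power M (Suc k) = M ** matrix_power M k"

definition matrix_exp :: "real^'n^'n \<Rightarrow> real^'n^'n" where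
  "matrix_exp M = (\<Sum>k. (1 / fact k) *\<^sub>R matrix_power M k)"

text \<open>The derivative is taken within the time domain \<open>S\<close>, hence one-sided at the
  end points of a compact interval.\<close>

definition residual ::
  "(real^'n \<Rightarrow> real^'n) \<Rightarrow> real set \<Rightarrow> (real \<Rightarrow> real^'n) \<Rightarrow> real \<Rightarrow> real^'n" where
  "residual R S u t = vector_derivative u (at t within S) - R (u t)"

definition galerkin_proj :: "real^'k^'n \<Rightarrow> real^'n^'n" where
  "galerkin_proj V = coarse_proj V"

definition apg_proj :: "real^'n^'n \<Rightarrow> real^'k^'n \<Rightarrow> real \<Rightarrow> real^'n^'n" where
  "apg_proj A V \<tau> = coarse_proj V ** (mat 1 + \<tau> *\<^sub>R (A ** fine_proj V))"

text \<open>The orthogonal (memory) contribution at time \<open>t\<close> of the coarse trajectory \<open>w\<close> at lag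
  \<open>\<zeta>\<close>; with \<open>P' = fine_proj V\<close> it is \<open>exp(\<zeta> P' A) P' A w(t - \<zeta>)\<close>.\<close>

definition memory_integrand ::
  "real^'n^'n \<Rightarrow> real^'k^'n \<Rightarrow> (real \<Rightarrow> real^'n) \<Rightarrow> real \<Rightarrow> real \<Rightarrow> real^'n" where
  "memory_integrand A V w t \<zeta> =
     matrix_exp (\<zeta> *\<^sub>R (fine_proj V ** A)) *v (fine_proj V *v (A *v w (t - \<zeta>)))"

end

theory Submission
  imports Defs
begin

text \<open>
  Write \<open>P\<close> and \<open>P'\<close> for the coarse and fine projections. Both residual bounds are triangle
  inequalities applied to an exact identity: the projected residual \<^emph>\<open>equals\<close> \<open>V\<^sup>T A\<close> applied to
  the memory integral over \<open>{0..t}\<close>, up to the term in \<open>\<tau>\<close> that the Adjoint Petrov-Galerkin projection subtracts.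

  The fine scales \<open>q = P' u\<^sub>F\<close> satisfy \<open>q' = P' A q + P' A u\<^sub>c\<close>, where \<open>u\<^sub>c = P u\<^sub>F\<close>, and
  \<open>q 0 = 0\<close> because the initial state is coarse. This is a linear system driven by the coarse
  trajectory, so variation of constants (\<open>variation_of_constants\<close>) gives \<open>q t\<close> as the integral
  of the memory integrand over \<open>{0..t}\<close>.

  On the other hand \<open>u\<^sub>c' = P A (u\<^sub>c + q)\<close>, so the residual of the coarse trajectory is
  \<open>P A q - P' A u\<^sub>c\<close>. The columns of \<open>V\<close> being orthonormal, its transpose annihilates the range of
  \<open>P'\<close> and satisfies \<open>V\<^sup>T P = V\<^sup>T\<close>. The Galerkin projection therefore leaves exactly \<open>V\<^sup>T A q\<close>. The
  Adjoint Petrov-Galerkin projection contributes in addition \<open>\<tau> V\<^sup>T A P'\<close> applied to the residual,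
  which is \<open>- \<tau> V\<^sup>T A P' A u\<^sub>c\<close>: the left endpoint rule for the recent part of the memory.
  Splitting the integral for \<open>q t\<close> at \<open>\<tau>\<close> yields both estimates.

  The derivative of the matrix exponential, on which variation of constants rests, is obtained
  entry by entry, since each entry of \<open>exp (t M)\<close> is a scalar power series in \<open>t\<close>.
\<close>

section \<open>The matrix product as a bounded bilinear operation\<close>

lemma bounded_bilinear_matrix_mult:
  "bounded_bilinear ((**) :: real^'m^'n \<Rightarrow> real^'p^'m \<Rightarrow> real^'p^'n)"
  unfolding bilinear_conv_bounded_bilinear[symmetric] bilinear_def
  by (auto intro!: linearI simp: matrix_matrix_mult_def vec_eq_iff algebra_simps
        sum.distrib sum_distrib_left)

lemma bounded_bilinear_matrix_vector_mult:
  "bounded_bilinear ((*v) :: real^'m^'n \<Rightarrow> real^'m \<Rightarrow> real^'n)"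
  unfolding bilinear_conv_bounded_bilinear[symmetric] bilinear_def
  by (auto intro!: linearI simp: matrix_vector_mult_def vec_eq_iff algebra_simps
        sum.distrib sum_distrib_left)

interpretation mm: bounded_bilinear "(**) :: real^'m^'n \<Rightarrow> real^'p^'m \<Rightarrow> real^'p^'n"
  by (rule bounded_bilinear_matrix_mult)

interpretation mv: bounded_bilinear "(*v) :: real^'m^'n \<Rightarrow> real^'m \<Rightarrow> real^'n"
  by (rule bounded_bilinear_matrix_vector_mult)

section \<open>The matrix exponential\<close>

lemma matrix_power_commute: "matrix_power M k ** M = M ** matrix_power M k"
  by (induction k) (simp_all add: matrix_mul_assoc [symmetric])

lemma matrix_power_scaleR: "matrix_power (t *\<^sub>R M) k = t ^ k *\<^sub>R matrix_power M k"
  by (induction k) (simp_all add: mm.scaleR_left mm.scaleR_right)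

text \<open>A bilinear operation on a finite-dimensional space is submultiplicative only up to a
  constant; that constant is absorbed into the base of the geometric bound.\<close>

lemma matrix_power_norm_bound:
  fixes M :: "real^'n^'n"
  obtains C where "\<And>k. norm (matrix_power M k) \<le> C ^ k * norm (mat 1 :: real^'n^'n)"
proof -
  obtain K where K: "K \<ge> 0" "\<And>(A :: real^'n^'n) (B :: real^'n^'n). norm (A ** B) \<le> norm A * norm B * K"
    using mm.nonneg_bounded by blast
  have "norm (matrix_power M k) \<le> (norm M * K) ^ k * norm (mat 1 :: real^'n^'n)" for k
  proof (induction k)
    case (Suc k)
    have "norm (matrix_power M (Suc k)) \<le> norm M * norm (matrix_power M k) * K"
      using K(2) by simp
    also have "\<dots> \<le> norm M * ((norm M * K) ^ k * norm (mat 1 :: real^'n^'n)) * K"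
      using K(1) Suc by (intro mult_right_mono mult_left_mono) auto
    finally show ?case by (simp add: mult_ac)
  qed simp
  then show ?thesis by (rule that)
qed

text \<open>The infinite sum that defines the exponential is meaningful only once the series is known to
  converge; it is dominated by a scalar exponential series.\<close>

lemma matrix_exp_sums:
  fixes M :: "real^'n^'n"
  shows "(\<lambda>k. (1 / fact k) *\<^sub>R matrix_power M k) sums matrix_exp M"
proof -
  obtain C where C: "\<And>k. norm (matrix_power M k) \<le> C ^ k * norm (mat 1 :: real^'n^'n)"
    using matrix_power_norm_bound by blast
  have "summable (\<lambda>k. inverse (fact k) * C ^ k * norm (mat 1 :: real^'n^'n))"
    by (intro summable_mult2 summable_exp)
  moreover have "norm ((1 / fact k) *\<^sub>R matrix_power M k)
      \<le> inverse (fact k) * C ^ k * norm (mat 1 :: real^'n^'n)" for k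
    using C[of k] by (simp add: field_simps)
  ultimately have "summable (\<lambda>k. (1 / fact k) *\<^sub>R matrix_power M k)"
    by (rule summable_comparison_test'[where N = 0])
  then show ?thesis
    unfolding matrix_exp_def by (rule summable_sums)
qed

lemma matrix_exp_0: "matrix_exp (0 :: real^'n^'n) = mat 1"
proof -
  have "(1 / fact k) *\<^sub>R matrix_power (0 :: real^'n^'n) k = (if k = 0 then mat 1 else 0)" for k
    by (cases k) auto
  then have "(\<lambda>k. (if k = 0 then mat 1 else 0)) sums matrix_exp (0 :: real^'n^'n)"
    using matrix_exp_sums[of "0 :: real^'n^'n"] by simp
  then show ?thesis
    using sums_If_finite[of "\<lambda>k. k = 0" "\<lambda>_. mat 1 :: real^'n^'n"]
    by (auto dest: sums_unique2)
qed

lemma has_vector_derivative_matrixI: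
  fixes F :: "real \<Rightarrow> real^'m^'n"
  assumes "\<And>i j. ((\<lambda>t. F t $ i $ j) has_real_derivative F' $ i $ j) (at t)"
  shows "(F has_vector_derivative F') (at t)"
  unfolding has_vector_derivative_def
proof (subst has_derivative_componentwise_within, intro ballI)
  fix b :: "real^'m^'n" assume "b \<in> Basis"
  then obtain i j where b: "b = axis i (axis j 1)"
    by (auto simp: Basis_vec_def)
  show "((\<lambda>t. F t \<bullet> b) has_derivative (\<lambda>h. (h *\<^sub>R F') \<bullet> b)) (at t)"
    using assms[of i j]
    by (simp add: b inner_axis has_field_derivative_def mult.commute[of "F' $ i $ j", abs_def])
qed

text \<open>Differentiating the power series of an entry shifts its coefficients by one. The shift
  replaces each power of \<open>M\<close> by the next one, that is, it multiplies the series by \<open>M\<close>; as \<open>M\<close>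
  commutes with its powers, the factor may be put on the right, where it will meet the factor \<open>M\<close>
  of the differential equation.\<close>

lemma matrix_exp_has_vector_derivative:
  fixes M :: "real^'n^'n"
  shows "((\<lambda>t. matrix_exp (t *\<^sub>R M)) has_vector_derivative matrix_exp (t *\<^sub>R M) ** M) (at t)"
proof (rule has_vector_derivative_matrixI)
  fix i j
  define c where "c k = matrix_power M k $ i $ j / fact k" for k
  have entry: "bounded_linear (\<lambda>X :: real^'n^'n. X $ i $ j)"
    by (rule bounded_linear_compose[OF bounded_linear_vec_nth bounded_linear_vec_nth])
  have sums: "(\<lambda>k. c k * s ^ k) sums (matrix_exp (s *\<^sub>R M) $ i $ j)" for s
    using bounded_linear.sums[OF entry matrix_exp_sums[of "s *\<^sub>R M"]]
    by (simp add: c_def matrix_power_scaleR mult_ac)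
  have "(\<lambda>k. ((1 / fact k) *\<^sub>R matrix_power (t *\<^sub>R M) k) ** M) sums (matrix_exp (t *\<^sub>R M) ** M)"
    by (rule bounded_linear.sums[OF mm.bounded_linear_left matrix_exp_sums])
  from bounded_linear.sums[OF entry this]
  have "(\<lambda>k. diffs c k * t ^ k) sums ((matrix_exp (t *\<^sub>R M) ** M) $ i $ j)"
    by (simp add: c_def diffs_def matrix_power_scaleR mm.scaleR_left matrix_power_commute
        fact_Suc mult_ac divide_simps)
  moreover have "((\<lambda>s. \<Sum>k. c k * s ^ k) has_real_derivative (\<Sum>k. diffs c k * t ^ k)) (at t)"
    by (rule termdiffs_strong_converges_everywhere) (rule sums_summable[OF sums])
  ultimately show "((\<lambda>s. matrix_exp (s *\<^sub>R M) $ i $ j) has_real_derivative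
      (matrix_exp (t *\<^sub>R M) ** M) $ i $ j) (at t)"
    by (simp add: sums_unique[OF sums, symmetric] sums_unique[symmetric])
qed

section \<open>Variation of constants\<close>

text \<open>The integral is a convolution in which the forcing is evaluated at the time \<open>t - z\<close>. As a
  function of the lag \<open>z\<close> the integrand has the explicit primitive \<open>- exp (z M) q (t - z)\<close>: in its
  derivative the contributions \<open>exp (z M) M q (t - z)\<close> of the two factors cancel.\<close>

lemma variation_of_constants:
  fixes M :: "real^'n^'n" and q f :: "real \<Rightarrow> real^'n"
  assumes "0 \<le> t"
    and q: "\<And>s. s \<in> {0..t} \<Longrightarrow> (q has_vector_derivative M *v q s + f s) (at s within {0..t})"
  shows "((\<lambda>z. matrix_exp (z *\<^sub>R M) *v f (t - z)) has_integral
      q t - matrix_exp (t *\<^sub>R M) *v q 0) {0..t}"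
proof -
  let ?G = "\<lambda>z. - (matrix_exp (z *\<^sub>R M) *v q (t - z))"
  have "(?G has_vector_derivative matrix_exp (z *\<^sub>R M) *v f (t - z)) (at z within {0..t})"
    if z: "z \<in> {0..t}" for z
  proof -
    have "((\<lambda>z. t - z) has_vector_derivative - 1) (at z within {0..t})"
      by (auto intro!: derivative_eq_intros)
    moreover have "(q has_vector_derivative M *v q (t - z) + f (t - z))
        (at (t - z) within (\<lambda>z. t - z) ` {0..t})"
      by (rule has_vector_derivative_within_subset[OF q]) (use z in auto)
    ultimately have "(q \<circ> (\<lambda>z. t - z) has_vector_derivative
        - 1 *\<^sub>R (M *v q (t - z) + f (t - z))) (at z within {0..t})"
      by (rule vector_diff_chain_within)
    then have "((\<lambda>z. q (t - z)) has_vector_derivative - (M *v q (t - z) + f (t - z)))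
        (at z within {0..t})"
      by (simp add: o_def)
    from mv.has_vector_derivative[OF
        has_vector_derivative_at_within[OF matrix_exp_has_vector_derivative[of M]] this]
    have "((\<lambda>z. matrix_exp (z *\<^sub>R M) *v q (t - z)) has_vector_derivative
        - (matrix_exp (z *\<^sub>R M) *v f (t - z))) (at z within {0..t})"
      by (simp add: mv.minus_right mv.add_right mv.diff_right matrix_vector_mul_assoc)
    from has_vector_derivative_minus[OF this] show ?thesis by simp
  qed
  from fundamental_theorem_of_calculus[OF \<open>0 \<le> t\<close> this]
  show ?thesis by (simp add: matrix_exp_0)
qed

section \<open>Coarse and fine scales\<close>

lemma orthonormal_columns_transpose_mult:
  assumes "orthonormal_columns V"
  shows "transpose V *v (V *v a) = a"
proof -
  have "transpose V ** V = mat 1"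
    using assms by (simp add: vec_eq_iff matrix_mult_transpose_dot_column
        orthonormal_columns_def mat_def)
  then show ?thesis by (simp add: matrix_vector_mul_assoc)
qed

lemma transpose_mult_coarse_proj:
  assumes "orthonormal_columns V"
  shows "transpose V *v (coarse_proj V *v x) = transpose V *v x"
  by (simp add: coarse_proj_def matrix_vector_mul_assoc[symmetric]
      orthonormal_columns_transpose_mult[OF assms] del: transpose_matrix_vector)

lemma coarse_plus_fine: "coarse_proj V *v x + fine_proj V *v x = x"
  by (simp add: coarse_proj_def fine_proj_def mv.diff_left)

lemma transpose_mult_fine_proj:
  assumes "orthonormal_columns V"
  shows "transpose V *v (fine_proj V *v x) = 0"
  using transpose_mult_coarse_proj[OF assms, of x]
    arg_cong[OF coarse_plus_fine[of V x], of "(*v) (transpose V)"]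
  by (simp add: mv.add_right)

text \<open>An initial state in the range of the trial basis has no fine-scale component.\<close>

lemma fine_proj_range:
  assumes "orthonormal_columns V"
  shows "fine_proj V *v (V *v a) = 0"
  by (simp add: fine_proj_def mv.diff_left matrix_vector_mul_assoc[symmetric]
      orthonormal_columns_transpose_mult[OF assms] del: transpose_matrix_vector)

lemma fine_proj_coarse_proj:
  assumes "orthonormal_columns V"
  shows "fine_proj V *v (coarse_proj V *v x) = 0"
  by (simp add: coarse_proj_def matrix_vector_mul_assoc[symmetric] fine_proj_range[OF assms])

lemma fine_proj_idem:
  assumes "orthonormal_columns V"
  shows "fine_proj V *v (fine_proj V *v x) = fine_proj V *v x"
  using fine_proj_coarse_proj[OF assms, of x]
    arg_cong[OF coarse_plus_fine[of V x], of "(*v) (fine_proj V)"]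
  by (simp add: mv.add_right)

section \<open>Residual bounds for the reduced-order models\<close>

theorem theorem3:
  fixes A :: "real^'n^'n" and V :: "real^'k^'n"
    and R :: "real^'n \<Rightarrow> real^'n"
    and u0 :: "real^'n" and uF uc :: "real \<Rightarrow> real^'n"
    and T t \<tau> :: real
  assumes "CARD('k) \<le> CARD('n)"
    and "T > 0"
    and "orthonormal_columns V"
    and "u0 \<in> range (\<lambda>a. V *v a)"
    and "\<And>x. R x = A *v x"
    and "\<And>s. s \<in> {0..T} \<Longrightarrow> (uF has_vector_derivative R (uF s)) (at s within {0..T})"
    and "uF 0 = u0"
    and "\<And>s. s \<in> {0..T} \<Longrightarrow> uc s = coarse_proj V *v uF s"
    and "t \<in> {0..T}"
    and "0 \<le> \<tau>" and "\<tau> \<le> t"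
  shows "norm (transpose V *v (galerkin_proj V *v residual R {0..T} uc t))
      \<le> norm (transpose V *v (A *v integral {0..\<tau>} (memory_integrand A V uc t)))
        + norm (transpose V *v (A *v integral {\<tau>..t} (memory_integrand A V uc t)))
    \<and> norm (transpose V *v (apg_proj A V \<tau> *v residual R {0..T} uc t))
      \<le> norm (transpose V *v (A *v integral {0..\<tau>} (memory_integrand A V uc t))
               - \<tau> *\<^sub>R (transpose V *v (A *v (fine_proj V *v (A *v uc t)))))
        + norm (transpose V *v (A *v integral {\<tau>..t} (memory_integrand A V uc t)))"
proof -
  let ?P = "coarse_proj V" and ?Q = "fine_proj V" and ?m = "memory_integrand A V uc t"
  define q where "q s = ?Q *v uF s" for s
  note orth = \<open>orthonormal_columns V\<close>
  \<comment> \<open>This rule would turn \<open>transpose V *v x\<close> into \<open>x v* V\<close>, out of reach of the projection lemmas.\<close>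
  note transpose_matrix_vector [simp del]
  have t: "0 \<le> t" "t \<le> T" using \<open>t \<in> {0..T}\<close> by auto
  have uF': "(uF has_vector_derivative A *v uF s) (at s within {0..T})" if "s \<in> {0..T}" for s
    using assms(5,6) that by simp
  have split: "uF s = uc s + q s" if "s \<in> {0..T}" for s
    using that assms(8) by (simp add: q_def coarse_plus_fine)

  \<comment> \<open>The derivative is restricted to \<open>{0..t}\<close>: the memory integral reaches back only from \<open>t\<close> to 0.\<close>
  have q': "(q has_vector_derivative (?Q ** A) *v q s + ?Q *v (A *v uc s)) (at s within {0..t})"
    if s: "s \<in> {0..t}" for s
  proof -
    have sT: "s \<in> {0..T}" using s t by auto
    have "(q has_vector_derivative ?Q *v (A *v uF s)) (at s within {0..T})"
      unfolding q_def
      by (rule bounded_linear.has_vector_derivative[OF mv.bounded_linear_right uF'[OF sT]])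
    then show ?thesis
      using t by (auto intro: has_vector_derivative_within_subset
          simp: split[OF sT] mv.add_right matrix_vector_mul_assoc add.commute)
  qed
  have "q 0 = 0"
    using assms(4,7) fine_proj_range[OF orth] by (auto simp: q_def)
  with variation_of_constants[OF t(1) q']
  have memory: "(?m has_integral q t) {0..t}"
    by (simp add: memory_integrand_def[abs_def])
  have "integral {0..\<tau>} ?m + integral {\<tau>..t} ?m = q t"
    using Henstock_Kurzweil_Integration.integral_combine[OF assms(10,11)
        has_integral_integrable[OF memory]] integral_unique[OF memory] by simp
  then have closure: "transpose V *v (A *v q t) =
      transpose V *v (A *v integral {0..\<tau>} ?m) + transpose V *v (A *v integral {\<tau>..t} ?m)"
    by (metis mv.add_right)

  \<comment> \<open>The time derivative is entirely coarse, so the fine part of \<open>A u\<^sub>c\<close> is left uncompensated.\<close>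
  have "((\<lambda>s. ?P *v uF s) has_vector_derivative ?P *v (A *v uF t)) (at t within {0..T})"
    by (rule bounded_linear.has_vector_derivative[OF mv.bounded_linear_right uF'[OF assms(9)]])
  then have "(uc has_vector_derivative ?P *v (A *v uF t)) (at t within {0..T})"
    using assms(8,9) by (rule_tac has_vector_derivative_transform) auto
  then have "vector_derivative uc (at t within {0..T}) = ?P *v (A *v uF t)"
    using t \<open>T > 0\<close> by (intro vector_derivative_within_closed_interval) auto
  then have "residual R {0..T} uc t = ?P *v (A *v q t) + ?P *v (A *v uc t) - A *v uc t"
    using assms(5) by (simp add: residual_def split[OF assms(9)] mv.add_right)
  then have res: "residual R {0..T} uc t = ?P *v (A *v q t) - ?Q *v (A *v uc t)"
    by (metis coarse_plus_fine add_diff_cancel_right' diff_diff_add)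

  have galerkin: "transpose V *v (galerkin_proj V *v residual R {0..T} uc t)
      = transpose V *v (A *v q t)"
    by (simp add: galerkin_proj_def transpose_mult_coarse_proj[OF orth] res mv.diff_right
        transpose_mult_fine_proj[OF orth])
  \<comment> \<open>The \<open>\<tau>\<close> term of the projection sees only the fine part of the residual, in which \<open>q\<close> is absent.\<close>
  have Q_res: "?Q *v residual R {0..T} uc t = - (?Q *v (A *v uc t))"
    by (simp add: res mv.diff_right fine_proj_coarse_proj[OF orth] fine_proj_idem[OF orth])
  have "apg_proj A V \<tau> *v residual R {0..T} uc t
      = ?P *v (residual R {0..T} uc t + \<tau> *\<^sub>R (A *v (?Q *v residual R {0..T} uc t)))"
    by (simp add: apg_proj_def matrix_vector_mul_assoc[symmetric] mv.add_left mv.scaleR_left)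
  then have apg: "transpose V *v (apg_proj A V \<tau> *v residual R {0..T} uc t)
      = transpose V *v (A *v q t) - \<tau> *\<^sub>R (transpose V *v (A *v (?Q *v (A *v uc t))))"
    using galerkin
    by (simp add: galerkin_proj_def Q_res transpose_mult_coarse_proj[OF orth] mv.add_right
        mv.diff_right mv.minus_right mv.scaleR_right)
  have "norm (a + b - c) \<le> norm (a - c) + norm b" for a b c :: "real^'k"
    using norm_triangle_ineq[of "a - c" b] by (simp add: algebra_simps)
  then show ?thesis
    unfolding galerkin apg closure by (intro conjI norm_triangle_ineq)
qed

end
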